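(* Let $T\subset\mathbb R^2$ be a closed axis-parallel square with vertices $\mathbf x_1$ (lower left), $\mathbf x_2$ (lower right), $\mathbf x_3$ (upper right), $\mathbf x_4$ (upper left), and let $$V_5(T)=\operatorname{span}\{P_5(T),\ b_5,b_6,b_7,b_8,b_{12},b_{14},b_{18},b_{19},b_{20},b_{21},b_{22}\},$$ where $b_1,\dots,b_{36}$ is the dual basis of $Q_5(T)$ described in the context. Then the following 32 degrees of freedom uniquely determine the functions in $V_5(T)$ (that is, for every choice of prescribed real values of these degrees of freedom there is exactly one $p\in V_5(T)$ attaining them): with $j'=3-j$, (1) $p(\mathbf x_i),\ \partial_x p(\mathbf x_i),\ \partial_y p(\mathbf x_i),\ \partial_{xy}p(\mathbf x_i)$, $i=1,2,3,4$; (2) $p\big(\tfrac{j\mathbf x_1+j'\mathbf x_2}{3}\big),\ \partial_y p\big(\tfrac{j\mathbf x_1+j'\mathbf x_2}{3}\big)$, $j=1,2$; (3) $p\big(\tfrac{j\mathbf x_2+j'\mathbf x_3}{3}\big),\ \partial_x p\big(\tfrac{j\mathbf x_2+j'\mathbf x_3}{3}\big)$, $j=1,2$; (4) $p\big(\tfrac{j\mathbf x_4+j'\mathbf x_3}{3}\big),\ \partial_y p\big(\tfrac{j\mathbf x_4+j'\mathbf x_3}{3}\big)$, $j=1,2$; (5) $p\big(\tfrac{j\mathbf x_1+j'\mathbf x_4}{3}\big),\ \partial_x p\big(\tfrac{j\mathbf x_1+j'\mathbf x_4}{3}\big)$, $j=1,2$.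
   Context: $P_k(T)$ is the space of real polynomials in $(x,y)$ of total degree at most $k$ on $T$; $Q_k(T)$ is the space of polynomials of degree at most $k$ in each variable separately. The 36 degrees of freedom $F_1,\dots,F_{36}$ of the $C^1$-$Q_5$ Bogner-Fox-Schmit element on $T$ are numbered in the order in which they are listed here. For $i=1,2,3,4$: $F_{4i-3}(p)=p(\mathbf x_i)$, $F_{4i-2}(p)=\partial_xp(\mathbf x_i)$, $F_{4i-1}(p)=\partial_yp(\mathbf x_i)$, $F_{4i}(p)=\partial_{xy}p(\mathbf x_i)$. Next, with $j'=3-j$ and for $j=1,2$ in turn on each edge: $F_{15+2j}(p)=p(\frac{j\mathbf x_1+j'\mathbf x_2}3)$, $F_{16+2j}(p)=\partial_yp(\frac{j\mathbf x_1+j'\mathbf x_2}3)$; $F_{19+2j}(p)=p(\frac{j\mathbf x_2+j'\mathbf x_3}3)$, $F_{20+2j}(p)=\partial_xp(\frac{j\mathbf x_2+j'\mathbf x_3}3)$; $F_{23+2j}(p)=p(\frac{j\mathbf x_4+j'\mathbf x_3}3)$, $F_{24+2j}(p)=\partial_yp(\frac{j\mathbf x_4+j'\mathbf x_3}3)$; $F_{27+2j}(p)=p(\frac{j\mathbf x_1+j'\mathbf x_4}3)$, $F_{28+2j}(p)=\partial_xp(\frac{j\mathbf x_1+j'\mathbf x_4}3)$. Finally $F_{33},\dots,F_{36}$ are the values $p\big(\frac{(j\mathbf x_1+j'\mathbf x_4)\ell+(j\mathbf x_2+j'\mathbf x_3)\ell'}{9}\big)$, $j,\ell\in\{1,2\}$,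 $\ell'=3-\ell$. These 36 functionals are unisolvent on $Q_5(T)$, and $b_1,\dots,b_{36}\in Q_5(T)$ denotes the dual basis: $F_m(b_n)=\delta_{mn}$. *)

theory Defs
  imports "HOL-Analysis.Analysis" "HOL-Library.Function_Algebras"
begin

text \<open>
  A polynomial on the square \<open>T\<close> is represented by the polynomial function on the whole plane;
  since \<open>T\<close> has nonempty interior, restriction to \<open>T\<close> loses nothing, and partial derivatives at
  boundary points of \<open>T\<close> are ordinary ones.
\<close>

type_synonym plane_fun = "real \<times> real \<Rightarrow> real"

definition fscale :: "real \<Rightarrow> plane_fun \<Rightarrow> plane_fun" where
  "fscale c f = (\<lambda>z. c * f z)"

interpretation plane_fun: vector_space fscale
  by unfold_locales (auto simp: fscale_def fun_eq_iff algebra_simps)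

definition mono2 :: "nat \<Rightarrow> nat \<Rightarrow> plane_fun" where
  "mono2 i j = (\<lambda>(x, y). x ^ i * y ^ j)"

definition P_space :: "nat \<Rightarrow> plane_fun set" where
  "P_space k = plane_fun.span {mono2 i j | i j. i + j \<le> k}"

definition Q_space :: "nat \<Rightarrow> plane_fun set" where
  "Q_space k = plane_fun.span {mono2 i j | i j. i \<le> k \<and> j \<le> k}"

definition dx :: "plane_fun \<Rightarrow> plane_fun" where
  "dx p = (\<lambda>(x, y). deriv (\<lambda>t. p (t, y)) x)"

definition dy :: "plane_fun \<Rightarrow> plane_fun" where
  "dy p = (\<lambda>(x, y). deriv (\<lambda>t. p (x, t)) y)"

definition dxy :: "plane_fun \<Rightarrow> plane_fun" where
  "dxy p = dy (dx p)"

definition axis_square :: "(real \<times> real) set \<Rightarrow> (nat \<Rightarrow> real \<times> real) \<Rightarrow> bool" where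
  "axis_square T x \<longleftrightarrow>
     (\<exists>h>0. x 2 = x 1 + (h, 0) \<and> x 3 = x 1 + (h, h) \<and> x 4 = x 1 + (0, h)
            \<and> T = cbox (x 1) (x 3))"

text \<open>\<open>third u v j\<close> is $(ju + j'v)/3$ with $j' = 3 - j$; only $j = 1, 2$ is used.\<close>

definition third :: "real \<times> real \<Rightarrow> real \<times> real \<Rightarrow> nat \<Rightarrow> real \<times> real" where
  "third u v j = (1 / 3) *\<^sub>R (real j *\<^sub>R u + real (3 - j) *\<^sub>R v)"

text \<open>The 32 degrees of freedom at the vertices and at the edge points.\<close>

definition boundary_dofs :: "(nat \<Rightarrow> real \<times> real) \<Rightarrow> (plane_fun \<Rightarrow> real) list" where
  "boundary_dofs x =
     concat (map (\<lambda>i. [\<lambda>p. p (x i), \<lambda>p. dx p (x i), \<lambda>p. dy p (x i), \<lambda>p. dxy p (x i)]) [1, 2, 3, 4])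
   @ concat (map (\<lambda>j. [\<lambda>p. p (third (x 1) (x 2) j), \<lambda>p. dy p (third (x 1) (x 2) j)]) [1, 2])
   @ concat (map (\<lambda>j. [\<lambda>p. p (third (x 2) (x 3) j), \<lambda>p. dx p (third (x 2) (x 3) j)]) [1, 2])
   @ concat (map (\<lambda>j. [\<lambda>p. p (third (x 4) (x 3) j), \<lambda>p. dy p (third (x 4) (x 3) j)]) [1, 2])
   @ concat (map (\<lambda>j. [\<lambda>p. p (third (x 1) (x 4) j), \<lambda>p. dx p (third (x 1) (x 4) j)]) [1, 2])"

text \<open>
  The values at $((j x_1 + j' x_4)\ell + (j x_2 + j' x_3)\ell')/9$, for $(j,\ell)$ in
  lexicographic order.
\<close>

definition interior_dofs :: "(nat \<Rightarrow> real \<times> real) \<Rightarrow> (plane_fun \<Rightarrow> real) list" where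
  "interior_dofs x =
     concat (map (\<lambda>j. map (\<lambda>l. \<lambda>p. p (third (third (x 1) (x 4) j) (third (x 2) (x 3) j) l)) [1, 2])
       [1, 2])"

lemma length_boundary_dofs: "length (boundary_dofs x) = 32"
  by (simp add: boundary_dofs_def)

lemma length_interior_dofs: "length (interior_dofs x) = 4"
  by (simp add: interior_dofs_def)

text \<open>\<open>bfs_dof x m\<close> is the functional $F_m$, numbered from 1 to 36.\<close>

definition bfs_dof :: "(nat \<Rightarrow> real \<times> real) \<Rightarrow> nat \<Rightarrow> plane_fun \<Rightarrow> real" where
  "bfs_dof x m = (boundary_dofs x @ interior_dofs x) ! (m - 1)"

definition bfs_dual_basis :: "(nat \<Rightarrow> real \<times> real) \<Rightarrow> (nat \<Rightarrow> plane_fun) \<Rightarrow> bool" where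
  "bfs_dual_basis x b \<longleftrightarrow>
     (\<forall>n\<in>{1..36}. b n \<in> Q_space 5 \<and>
        (\<forall>m\<in>{1..36}. bfs_dof x m (b n) = (if m = n then 1 else 0)))"

definition V5 :: "(nat \<Rightarrow> plane_fun) \<Rightarrow> plane_fun set" where
  "V5 b = plane_fun.span (P_space 5 \<union> b ` {5, 6, 7, 8, 12, 14, 18, 19, 20, 21, 22})"

end

theory Submission
  imports Defs
begin

text \<open>
  The eleven functions \<open>b\<^sub>n\<close> are dual to their own functionals and are annihilated by the other 21
  boundary functionals, so everything reduces to the unisolvence of these 21 functionals on
  \<open>P\<^sub>5\<close>. By dimension it suffices to show that \<open>q \<in> P\<^sub>5\<close> vanishes if they do. In
  coordinates in which the square is \<open>[0,1]\<^sup>2\<close>, the data on the left edge make \<open>q\<close> and then its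
  \<open>x\<close>-derivative vanish there, the data on the top edge remove the factor \<open>(1 - y)\<^sup>2\<close> from
  \<open>q / x\<^sup>2\<close>, and the remaining affine factor is killed by the three remaining functionals.
\<close>

section \<open>Square linear systems over the reals\<close>

lemma sum_fun_apply:
  fixes f :: "'a \<Rightarrow> 'b \<Rightarrow> 'c::comm_monoid_add"
  shows "sum f A z = (\<Sum>i\<in>A. f i z)"
  by (induction A rule: infinite_finite_induct) auto

text \<open>The columns are independent by \<open>kernel\<close>, and there are
  \<open>card J\<close> of them, so they span all right-hand sides: one outside their span would
  give too many independent vectors.\<close>

lemma square_system_solvable:
  fixes A :: "'j \<Rightarrow> 'i \<Rightarrow> real"
  assumes fin: "finite I" "finite J" and card: "card I = card J"
    and kernel: "\<And>c. \<forall>j\<in>J. (\<Sum>i\<in>I. c i * A j i) = 0 \<Longrightarrow> \<forall>i\<in>I. c i = 0"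
  shows "\<exists>c. \<forall>j\<in>J. (\<Sum>i\<in>I. c i * A j i) = v j"
proof -
  define sc where "sc = (\<lambda>(a::real) (f::'j \<Rightarrow> real) x. a * f x)"
  interpret V: vector_space sc
    by unfold_locales (auto simp: sc_def fun_eq_iff algebra_simps)
  \<comment> \<open>Functions vanishing outside \<open>J\<close> model the space of right-hand
    sides; \<open>C i\<close> is a column of the matrix and \<open>e k\<close> a unit
    vector.\<close>
  define C where "C i j = (if j \<in> J then A j i else 0)" for i j
  define e where "e k j = (if j = k then 1 else 0 :: real)" for k j :: 'j
  have in_span: "f \<in> V.span (e ` J)" if "\<And>j. j \<notin> J \<Longrightarrow> f j = 0" for f
  proof -
    have "f j = (\<Sum>k\<in>J. f k * e k j)" for j
    proof -
      have "(\<Sum>k\<in>J. f k * e k j) = (\<Sum>k\<in>J. if k = j then f k else 0)"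
        by (intro sum.cong) (auto simp: e_def)
      thus ?thesis
        using fin that by simp
    qed
    hence "f = (\<Sum>k\<in>J. sc (f k) (e k))"
      unfolding fun_eq_iff sum_fun_apply sc_def by blast
    also have "\<dots> \<in> V.span (e ` J)"
      by (intro V.span_sum V.span_scale V.span_base imageI)
    finally show ?thesis .
  qed
  have kernel_C: "\<forall>i\<in>I. c i = 0" if "(\<Sum>i\<in>I. sc (c i) (C i)) = 0" for c
  proof (rule kernel, rule ballI)
    fix j assume "j \<in> J"
    thus "(\<Sum>i\<in>I. c i * A j i) = 0"
      using fun_cong[OF that, of j] by (simp add: sum_fun_apply sc_def C_def)
  qed
  have inj: "inj_on C I"
  proof (rule inj_onI, rule ccontr)
    fix i i' assume i: "i \<in> I" "i' \<in> I" "C i = C i'" "i \<noteq> i'"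
    let ?c = "\<lambda>k. if k = i then 1 else if k = i' then -1 else 0 :: real"
    have "(\<Sum>k\<in>I. sc (?c k) (C k)) = (\<Sum>k\<in>{i, i'}. sc (?c k) (C k))"
      using fin i by (intro sum.mono_neutral_right) (auto simp: sc_def fun_eq_iff)
    also have "\<dots> = 0"
      using i by (simp add: sc_def fun_eq_iff)
    finally show False
      using kernel_C[of ?c] i by auto
  qed
  have indep: "V.independent (C ` I)"
  proof
    assume "V.dependent (C ` I)"
    then obtain u where u: "\<exists>f\<in>C ` I. u f \<noteq> 0" "(\<Sum>f\<in>C ` I. sc (u f) f) = 0"
      using V.dependent_finite fin by blast
    have "(\<Sum>i\<in>I. sc (u (C i)) (C i)) = 0"
      using u(2) inj by (simp add: sum.reindex)
    from kernel_C[OF this] u(1) show False by auto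
  qed
  define w where "w j = (if j \<in> J then v j else 0)" for j
  have "w \<in> V.span (C ` I)"
  proof (rule ccontr)
    assume w: "w \<notin> V.span (C ` I)"
    have "V.independent (insert w (C ` I))"
      using indep w by (simp add: V.independent_insert)
    moreover have "insert w (C ` I) \<subseteq> V.span (e ` J)"
      by (auto intro!: in_span simp: C_def w_def)
    ultimately have "card (insert w (C ` I)) \<le> card (e ` J)"
      using V.independent_span_bound fin by blast
    moreover have "card (insert w (C ` I)) = Suc (card I)"
      using fin inj w V.span_base by (subst card_insert_disjoint) (auto simp: card_image)
    ultimately show False
      using card card_image_le[OF fin(2), of e] by simp
  qed
  then obtain u where "w = (\<Sum>f\<in>C ` I. sc (u f) f)"
    using V.span_finite fin by auto
  hence w: "w = (\<Sum>i\<in>I. sc (u (C i)) (C i))"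
    using inj by (simp add: sum.reindex)
  have "(\<Sum>i\<in>I. u (C i) * A j i) = v j" if "j \<in> J" for j
    using fun_cong[OF w, of j] that by (simp add: sum_fun_apply sc_def C_def w_def)
  hence "\<forall>j\<in>J. (\<Sum>i\<in>I. u (C i) * A j i) = v j" by blast
  thus ?thesis by (intro exI[of _ "\<lambda>i. u (C i)"])
qed

section \<open>Monomials in local coordinates\<close>

text \<open>With \<open>(a, b)\<close> the lower left vertex and \<open>h\<close> the side length,
  these are the monomials in coordinates that turn the square into the unit square.\<close>

definition lmono :: "real \<Rightarrow> real \<Rightarrow> real \<Rightarrow> nat \<Rightarrow> nat \<Rightarrow> plane_fun" where
  "lmono a b h i j = (\<lambda>(x, y). ((x - a) / h) ^ i * ((y - b) / h) ^ j)"

lemma mono2_eq_lmono: "mono2 i j = lmono 0 0 1 i j"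
  by (simp add: mono2_def lmono_def)

lemma fscale_apply: "fscale c f z = c * f z"
  by (simp add: fscale_def)

text \<open>Each local coordinate is an affine function of the same coordinate in the other system.
  The binomial theorem in both variables yields only exponents \<open>r \<le> i\<close> and
  \<open>s \<le> j\<close>, so the total degree does not grow.\<close>

lemma lmono_in_span_lmono:
  assumes "h \<noteq> 0" "h' \<noteq> 0" "i + j \<le> k"
  shows "lmono a b h i j \<in> plane_fun.span {lmono a' b' h' i j | i j. i + j \<le> k}"
proof -
  have split: "(t - c) / h = h' / h * ((t - c') / h') + (c' - c) / h" for t c c' :: real
    using assms by (simp add: field_simps)
  have "lmono a b h i j = (\<Sum>r\<le>i. \<Sum>s\<le>j.
      fscale (of_nat (i choose r) * (h' / h) ^ r * ((a' - a) / h) ^ (i - r) *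
        (of_nat (j choose s) * (h' / h) ^ s * ((b' - b) / h) ^ (j - s))) (lmono a' b' h' r s))"
    (is "_ = ?R")
  proof
    fix z :: "real \<times> real"
    obtain x y where z: "z = (x, y)" by force
    have "lmono a b h i j z = (h' / h * ((x - a') / h') + (a' - a) / h) ^ i *
        (h' / h * ((y - b') / h') + (b' - b) / h) ^ j"
      by (simp only: z lmono_def prod.case split[symmetric])
    also have "\<dots> = ?R z"
      unfolding binomial_ring sum_product sum_fun_apply fscale_apply
      by (simp only: lmono_def z prod.case power_mult_distrib mult_ac)
    finally show "lmono a b h i j z = ?R z" .
  qed
  also have "?R \<in> plane_fun.span {lmono a' b' h' i j | i j. i + j \<le> k}"
    by (intro plane_fun.span_sum plane_fun.span_scale plane_fun.span_base)
      (use assms in fastforce)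
  finally show ?thesis .
qed

lemma P_space_eq_span_lmono:
  assumes "h \<noteq> 0"
  shows "P_space k = plane_fun.span {lmono a b h i j | i j. i + j \<le> k}"
  unfolding P_space_def mono2_eq_lmono
  by (rule plane_fun.span_eq[THEN iffD2]) (use assms in \<open>auto intro!: lmono_in_span_lmono\<close>)

section \<open>Polynomials, partial derivatives and linear functionals\<close>

text \<open>A common home for \<open>P_space 5\<close> and \<open>Q_space 5\<close>. Since
  \<open>deriv\<close> respects sums only under differentiability, linearity of the functionals is
  claimed on this space alone.\<close>

abbreviation polys :: "plane_fun set" where
  "polys \<equiv> plane_fun.span (range (\<lambda>(i, j). mono2 i j))"

lemma P_space_subset_polys: "P_space k \<subseteq> polys"
  unfolding P_space_def by (rule plane_fun.span_mono) auto

lemma Q_space_subset_polys: "Q_space k \<subseteq> polys"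
  unfolding Q_space_def by (rule plane_fun.span_mono) auto

lemma lmono_in_P_space: "h \<noteq> 0 \<Longrightarrow> i + j \<le> k \<Longrightarrow> lmono a b h i j \<in> P_space k"
  unfolding P_space_eq_span_lmono[of h k a b] by (rule plane_fun.span_base) auto

lemma polys_differentiable:
  assumes "p \<in> polys"
  shows "(\<lambda>t. p (t, y)) field_differentiable at x" "(\<lambda>t. p (x, t)) field_differentiable at y"
proof -
  have "(\<lambda>t. p (t, y)) field_differentiable at x \<and> (\<lambda>t. p (x, t)) field_differentiable at y"
    using assms
    by (induction rule: plane_fun.span_induct_alt)
      (auto simp: fscale_def mono2_def intro!: derivative_intros)
  thus "(\<lambda>t. p (t, y)) field_differentiable at x" "(\<lambda>t. p (x, t)) field_differentiable at y"
    by auto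
qed

lemma dx_add: "p \<in> polys \<Longrightarrow> q \<in> polys \<Longrightarrow> dx (p + q) = dx p + dx q"
  by (auto simp: dx_def fun_eq_iff polys_differentiable)

lemma dy_add: "p \<in> polys \<Longrightarrow> q \<in> polys \<Longrightarrow> dy (p + q) = dy p + dy q"
  by (auto simp: dy_def fun_eq_iff polys_differentiable)

lemma dx_fscale: "p \<in> polys \<Longrightarrow> dx (fscale c p) = fscale c (dx p)"
  by (auto simp: dx_def fscale_def fun_eq_iff polys_differentiable)

lemma dy_fscale: "p \<in> polys \<Longrightarrow> dy (fscale c p) = fscale c (dy p)"
  by (auto simp: dy_def fscale_def fun_eq_iff polys_differentiable)

text \<open>The truncated exponent for \<open>i = 0\<close> is harmless because its coefficient is
  zero; for \<open>h = 0\<close> both sides vanish, as division by zero gives zero.\<close>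

lemma dx_lmono: "dx (lmono a b h i j) = fscale (of_nat i / h) (lmono a b h (i - 1) j)"
proof -
  have "((\<lambda>t. ((t - a) / h) ^ i * ((y - b) / h) ^ j) has_field_derivative
      of_nat i / h * (((x - a) / h) ^ (i - 1) * ((y - b) / h) ^ j)) (at x)" for x y
    by (cases "h = 0") (auto intro!: derivative_eq_intros)
  thus ?thesis
    by (auto simp: dx_def lmono_def fscale_def fun_eq_iff intro!: DERIV_imp_deriv)
qed

lemma dy_lmono: "dy (lmono a b h i j) = fscale (of_nat j / h) (lmono a b h i (j - 1))"
proof -
  have "((\<lambda>t. ((x - a) / h) ^ i * ((t - b) / h) ^ j) has_field_derivative
      of_nat j / h * (((x - a) / h) ^ i * ((y - b) / h) ^ (j - 1))) (at y)" for x y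
    by (cases "h = 0") (auto intro!: derivative_eq_intros)
  thus ?thesis
    by (auto simp: dy_def lmono_def fscale_def fun_eq_iff intro!: DERIV_imp_deriv)
qed

lemma mono2_in_polys: "mono2 i j \<in> polys"
  by (intro plane_fun.span_base image_eqI[of _ _ "(i, j)"]) auto

text \<open>Needed for \<open>dxy\<close>, where linearity of \<open>dy\<close> is applied to
  functions of the form \<open>dx p\<close>.\<close>

lemma dx_in_polys:
  assumes "p \<in> polys"
  shows "dx p \<in> polys"
proof -
  \<comment> \<open>Membership of \<open>p\<close> is carried along because \<open>dx_add\<close>
    asks for it in the induction step.\<close>
  have "p \<in> polys \<and> dx p \<in> polys"
    using assms
  proof (induction rule: plane_fun.span_induct_alt)
    case base
    have "dx 0 = 0"
      by (auto simp: dx_def fun_eq_iff)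
    with plane_fun.span_zero show ?case by (simp only:)
  next
    case (step c f p)
    then obtain i j where f: "f = mono2 i j" by auto
    have f_in: "f \<in> polys"
      unfolding f by (rule mono2_in_polys)
    have "dx f \<in> polys"
      unfolding f mono2_eq_lmono dx_lmono
      unfolding mono2_eq_lmono[symmetric] by (intro plane_fun.span_scale mono2_in_polys)
    moreover have "dx (fscale c f + p) = fscale c (dx f) + dx p"
      using step f_in by (simp only: dx_add dx_fscale plane_fun.span_scale)
    ultimately show ?case
      using step f_in by (simp only: plane_fun.span_add plane_fun.span_scale simp_thms)
  qed
  thus ?thesis by blast
qed

definition linear_on_polys :: "(plane_fun \<Rightarrow> real) \<Rightarrow> bool" where
  "linear_on_polys F \<longleftrightarrow>
     (\<forall>p\<in>polys. \<forall>q\<in>polys. F (p + q) = F p + F q) \<and> (\<forall>c. \<forall>p\<in>polys. F (fscale c p) = c * F p)"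

lemma linear_on_polys_eval:
  "linear_on_polys (\<lambda>p. p z)" "linear_on_polys (\<lambda>p. dx p z)"
  "linear_on_polys (\<lambda>p. dy p z)" "linear_on_polys (\<lambda>p. dxy p z)"
  by (simp_all add: linear_on_polys_def dxy_def dx_add dy_add dx_fscale dy_fscale dx_in_polys
      fscale_apply)

lemma linear_on_polys_bfs_dof: "m \<in> {1..36} \<Longrightarrow> linear_on_polys (bfs_dof x m)"
proof -
  assume "m \<in> {1..36}"
  hence "bfs_dof x m \<in> set (boundary_dofs x @ interior_dofs x)"
    unfolding bfs_dof_def by (intro nth_mem) (auto simp: length_boundary_dofs length_interior_dofs)
  thus ?thesis
    by (auto simp: boundary_dofs_def interior_dofs_def linear_on_polys_eval)
qed

lemma linear_on_polys_sum:
  assumes "linear_on_polys F" "\<And>i. i \<in> I \<Longrightarrow> g i \<in> polys"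
  shows "F (\<Sum>i\<in>I. fscale (c i) (g i)) = (\<Sum>i\<in>I. c i * F (g i))"
proof -
  have "F 0 = 0"
    using assms(1) plane_fun.span_zero plane_fun.scale_zero_left
    unfolding linear_on_polys_def by (metis mult_zero_left)
  with assms show ?thesis
    by (induction I rule: infinite_finite_induct)
      (auto simp: linear_on_polys_def plane_fun.span_sum plane_fun.span_scale)
qed

section \<open>Quintic polynomials on the unit square\<close>

definition P5_indices :: "(nat \<times> nat) set" where
  "P5_indices = (SIGMA i:{..5}. {..5 - i})"

text \<open>Writing out all 21 terms lets the simplifier turn each functional into an explicit
  linear equation in the coefficients.\<close>

lemma sum_P5_indices:
  "(\<Sum>k\<in>P5_indices. f k) =
     f (0, 0) + f (0, 1) + f (0, 2) + f (0, 3) + f (0, 4) + f (0, 5) +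
     f (1, 0) + f (1, 1) + f (1, 2) + f (1, 3) + f (1, 4) +
     f (2, 0) + f (2, 1) + f (2, 2) + f (2, 3) +
     f (3, 0) + f (3, 1) + f (3, 2) + f (4, 0) + f (4, 1) + (f (5, 0) :: real)"
proof -
  have "(\<Sum>k\<in>P5_indices. f k) = (\<Sum>i\<le>5. \<Sum>j\<le>5 - i. f (i, j))"
    unfolding P5_indices_def by (subst sum.Sigma) auto
  thus ?thesis
    by (simp add: eval_nat_numeral)
qed

text \<open>
  The derivative of order \<open>k\<close> in \<open>x\<close> and \<open>l\<close> in \<open>y\<close> at \<open>(s, t)\<close> of the polynomial with
  coefficients \<open>c\<close>; the factor \<open>i\<^sup>k j\<^sup>l\<close> is correct for \<open>k, l \<le> 1\<close> only.
\<close>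

definition P5_deriv :: "(nat \<times> nat \<Rightarrow> real) \<Rightarrow> nat \<Rightarrow> nat \<Rightarrow> real \<Rightarrow> real \<Rightarrow> real" where
  "P5_deriv c k l s t = (\<Sum>(i, j)\<in>P5_indices.
     c (i, j) * (of_nat (i ^ k * j ^ l) * s ^ (i - k) * t ^ (j - l)))"

lemma P5_deriv_kernel:
  fixes c :: "nat \<times> nat \<Rightarrow> real"
  assumes left: "P5_deriv c 0 0 0 0 = 0" "P5_deriv c 0 1 0 0 = 0" "P5_deriv c 0 0 0 1 = 0"
      "P5_deriv c 0 1 0 1 = 0" "P5_deriv c 0 0 0 (1/3) = 0" "P5_deriv c 0 0 0 (2/3) = 0"
    and left_dx: "P5_deriv c 1 0 0 0 = 0" "P5_deriv c 1 1 0 0 = 0" "P5_deriv c 1 1 0 1 = 0"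
      "P5_deriv c 1 0 0 (1/3) = 0" "P5_deriv c 1 0 0 (2/3) = 0"
    and top: "P5_deriv c 0 0 1 1 = 0" "P5_deriv c 1 0 1 1 = 0"
      "P5_deriv c 0 0 (1/3) 1 = 0" "P5_deriv c 0 0 (2/3) 1 = 0"
    and top_dy: "P5_deriv c 0 1 1 1 = 0" "P5_deriv c 0 1 (1/3) 1 = 0" "P5_deriv c 0 1 (2/3) 1 = 0"
    and rest: "P5_deriv c 0 0 (2/3) 0 = 0" "P5_deriv c 0 0 1 (1/3) = 0" "P5_deriv c 1 0 1 (1/3) = 0"
  shows "\<forall>k\<in>P5_indices. c k = 0"
proof -
  note D = P5_deriv_def sum_P5_indices
  note [simp] = power_divide
  note left = left[unfolded D, simplified]
  \<comment> \<open>The quintic \<open>q(0, t)\<close> has six data: values at 0, 1/3, 2/3, 1 and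
    derivatives at both ends.\<close>
  have 0 [simp]: "c (0, 0) = 0" "c (0, Suc 0) = 0" "c (0, 2) = 0" "c (0, 3) = 0" "c (0, 4) = 0"
      "c (0, 5) = 0"
    using left by linarith+
  note left_dx = left_dx[unfolded D, simplified]
  \<comment> \<open>The quartic \<open>q_x(0, t)\<close> has zeros at 1/3 and 2/3 and a double zero
    at 0, so it is a multiple of \<open>t^2 (t - 1/3) (t - 2/3)\<close>, whose derivative at 1 is
    13/9.\<close>
  have 1 [simp]: "c (Suc 0, 0) = 0" "c (Suc 0, Suc 0) = 0" "c (Suc 0, 2) = 0" "c (Suc 0, 3) = 0"
      "c (Suc 0, 4) = 0"
    using left_dx by linarith+
  note top = top[unfolded D, simplified]
  \<comment> \<open>Now \<open>q = s^2 r\<close> with \<open>r\<close> cubic. These four sums are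
    the coefficients of \<open>r(s, 1)\<close>, which vanishes at 1/3 and 2/3 and doubly at
    1.\<close>
  have 2: "c (2, 0) + c (2, Suc 0) + c (2, 2) + c (2, 3) = 0"
      "c (3, 0) + c (3, Suc 0) + c (3, 2) = 0" "c (4, 0) + c (4, Suc 0) = 0"
    and [simp]: "c (5, 0) = 0"
    using top by linarith+
  note top_dy = top_dy[unfolded D, simplified]
  \<comment> \<open>The quadratic \<open>r_t(s, 1)\<close> vanishes at 1/3, 2/3 and 1.\<close>
  have [simp]: "c (2, Suc 0) = - 2 * c (2, 2) - 3 * c (2, 3)" "c (3, Suc 0) = - 2 * c (3, 2)"
      "c (4, Suc 0) = 0"
    using top_dy by linarith+
  \<comment> \<open>What is left is \<open>s^2 (1 - t)^2\<close> times the affine factor with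
    constant term \<open>c (2, 2) + 2 * c (2, 3)\<close>, \<open>s\<close>-coefficient
    \<open>c (3, 2)\<close> and \<open>t\<close>-coefficient \<open>c (2, 3)\<close>.\<close>
  have [simp]: "c (2, 0) = c (2, 2) + 2 * c (2, 3)" "c (3, 0) = c (3, 2)" "c (4, 0) = 0"
    using 2 by simp_all
  note rest = rest[unfolded D, simplified]
  \<comment> \<open>The value and \<open>s\<close>-derivative at (1, 1/3) annihilate the
    \<open>s\<close>-slope of the affine factor; its zeros at (2/3, 0) and (1, 1/3) then annihilate
    the rest.\<close>
  have [simp]: "c (2, 2) = 0" "c (2, 3) = 0" "c (3, 2) = 0"
    using rest by (simp_all add: field_simps)
  \<comment> \<open>A vanishing sum of absolute values passes from the listed coefficients to all
    indices.\<close>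
  have "(\<Sum>k\<in>P5_indices. \<bar>c k\<bar>) = 0"
    unfolding sum_P5_indices by simp
  thus ?thesis
    by (subst (asm) sum_nonneg_eq_0_iff) (auto simp: P5_indices_def)
qed

section \<open>Unisolvence of the remaining functionals on the quintics\<close>

text \<open>Coefficients are indexed by \<open>I\<close> and not by the image, so repeated values of
  \<open>g\<close> do no harm: a new scalar is added at a single preimage.\<close>

lemma in_span_imageE:
  assumes "finite I" "s \<in> plane_fun.span (g ` I)"
  obtains c where "s = (\<Sum>i\<in>I. fscale (c i) (g i))"
proof -
  have "\<exists>c. s = (\<Sum>i\<in>I. fscale (c i) (g i))"
    using assms(2)
  proof (induction rule: plane_fun.span_induct_alt)
    case base
    show ?case by (intro exI[of _ "\<lambda>_. 0"]) simp
  next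
    case (step r f s)
    then obtain i c where i: "i \<in> I" "f = g i" and s: "s = (\<Sum>i\<in>I. fscale (c i) (g i))"
      by auto
    have "(\<Sum>k\<in>I. fscale (if k = i then r else 0) (g k)) = fscale r f"
      using sum.remove[OF assms(1) i(1), of "\<lambda>k. fscale (if k = i then r else 0) (g k)"] i
      by (simp only: if_True) (simp add: sum.neutral)
    hence "fscale r f + s = (\<Sum>k\<in>I. fscale ((if k = i then r else 0) + c k) (g k))"
      by (simp only: s plane_fun.scale_left_distrib sum.distrib)
    thus ?case
      by (intro exI[of _ "\<lambda>k. (if k = i then r else 0) + c k"])
  qed
  thus ?thesis using that by blast
qed

abbreviation added_dofs :: "nat set" where
  "added_dofs \<equiv> {5, 6, 7, 8, 12, 14, 18, 19, 20, 21, 22}"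

text \<open>There are 32 - 11 = 21 of these, which is the dimension of
  \<open>P_space 5\<close>.\<close>

definition P5_dofs :: "nat set" where
  "P5_dofs = {1..32} - added_dofs"

text \<open>The chart \<open>Z\<close> carries the functionals to the unit square, each derivative
  changing by a factor \<open>h\<close>, and \<open>P5_deriv_kernel\<close> applies there.\<close>

lemma P5_dofs_kernel:
  fixes L :: "nat \<times> nat \<Rightarrow> plane_fun"
  assumes h: "h \<noteq> 0"
    and x: "x 1 = (a, b)" "x 2 = (a + h, b)" "x 3 = (a + h, b + h)" "x 4 = (a, b + h)"
    and L: "L = (\<lambda>(i, j). lmono a b h i j)"
    and zero: "\<forall>m\<in>P5_dofs. (\<Sum>k\<in>P5_indices. c k * bfs_dof x m (L k)) = 0"
  shows "\<forall>k\<in>P5_indices. c k = 0"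
proof -
  define Z where "Z s t = (a + h * s, b + h * t)" for s t
  have lmono_Z: "lmono a b h i j (Z s t) = s ^ i * t ^ j" for i j s t
    using h by (simp add: lmono_def Z_def)
  have D00: "P5_deriv c 0 0 s t = (\<Sum>k\<in>P5_indices. c k * L k (Z s t))" for s t
    unfolding P5_deriv_def by (intro sum.cong refl) (use h in \<open>auto simp: L lmono_Z\<close>)
  have D10: "P5_deriv c 1 0 s t = h * (\<Sum>k\<in>P5_indices. c k * dx (L k) (Z s t))" for s t
    unfolding P5_deriv_def sum_distrib_left
    by (intro sum.cong refl) (use h in \<open>auto simp: L dx_lmono fscale_apply lmono_Z\<close>)
  have D01: "P5_deriv c 0 1 s t = h * (\<Sum>k\<in>P5_indices. c k * dy (L k) (Z s t))" for s t
    unfolding P5_deriv_def sum_distrib_left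
    by (intro sum.cong refl) (use h in \<open>auto simp: L dy_lmono fscale_apply lmono_Z\<close>)
  have dxy_L: "dxy (lmono a b h i j) =
      fscale (of_nat i / h) (fscale (of_nat j / h) (lmono a b h (i - 1) (j - 1)))" for i j
  proof -
    have "lmono a b h (i - 1) j \<in> polys"
      using lmono_in_P_space[OF h order_refl] P_space_subset_polys by blast
    thus ?thesis
      unfolding dxy_def dx_lmono by (simp only: dy_fscale dy_lmono)
  qed
  have D11: "P5_deriv c 1 1 s t = h\<^sup>2 * (\<Sum>k\<in>P5_indices. c k * dxy (L k) (Z s t))" for s t
    unfolding P5_deriv_def sum_distrib_left
    by (intro sum.cong refl)
      (use h in \<open>auto simp: L dxy_L fscale_apply lmono_Z power2_eq_square\<close>)
  \<comment> \<open>The functionals at the vertex \<open>x 2\<close> are numbers 5 to 8, all in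
    \<open>added_dofs\<close>.\<close>
  have vertices: "x 1 = Z 0 0" "x 3 = Z 1 1" "x 4 = Z 0 1"
    unfolding x by (simp_all add: Z_def)
  \<comment> \<open>The weight \<open>j\<close> sits on the first point, so \<open>j = 1\<close>
    gives the point nearer to the second one.\<close>
  have thirds: "third (x 1) (x 2) 1 = Z (2/3) 0" "third (x 2) (x 3) 2 = Z 1 (1/3)"
      "third (x 4) (x 3) 1 = Z (2/3) 1" "third (x 4) (x 3) 2 = Z (1/3) 1"
      "third (x 1) (x 4) 1 = Z 0 (2/3)" "third (x 1) (x 4) 2 = Z 0 (1/3)"
    unfolding x third_def Z_def by (simp_all add: field_simps)
  have dofs:
    "bfs_dof x 1 = (\<lambda>p. p (Z 0 0))" "bfs_dof x 2 = (\<lambda>p. dx p (Z 0 0))"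
    "bfs_dof x 3 = (\<lambda>p. dy p (Z 0 0))" "bfs_dof x 4 = (\<lambda>p. dxy p (Z 0 0))"
    "bfs_dof x 9 = (\<lambda>p. p (Z 1 1))" "bfs_dof x 10 = (\<lambda>p. dx p (Z 1 1))"
    "bfs_dof x 11 = (\<lambda>p. dy p (Z 1 1))"
    "bfs_dof x 13 = (\<lambda>p. p (Z 0 1))" "bfs_dof x 15 = (\<lambda>p. dy p (Z 0 1))"
    "bfs_dof x 16 = (\<lambda>p. dxy p (Z 0 1))" "bfs_dof x 17 = (\<lambda>p. p (Z (2/3) 0))"
    "bfs_dof x 23 = (\<lambda>p. p (Z 1 (1/3)))" "bfs_dof x 24 = (\<lambda>p. dx p (Z 1 (1/3)))"
    "bfs_dof x 25 = (\<lambda>p. p (Z (2/3) 1))" "bfs_dof x 26 = (\<lambda>p. dy p (Z (2/3) 1))"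
    "bfs_dof x 27 = (\<lambda>p. p (Z (1/3) 1))" "bfs_dof x 28 = (\<lambda>p. dy p (Z (1/3) 1))"
    "bfs_dof x 29 = (\<lambda>p. p (Z 0 (2/3)))" "bfs_dof x 30 = (\<lambda>p. dx p (Z 0 (2/3)))"
    "bfs_dof x 31 = (\<lambda>p. p (Z 0 (1/3)))" "bfs_dof x 32 = (\<lambda>p. dx p (Z 0 (1/3)))"
    unfolding bfs_dof_def boundary_dofs_def list.map concat.simps append.simps
    unfolding thirds unfolding vertices by simp_all
  have "{1, 2, 3, 4, 9, 10, 11, 13, 15, 16, 17, 23, 24, 25, 26, 27, 28, 29, 30, 31, 32} \<subseteq> P5_dofs"
    by (simp add: P5_dofs_def)
  with zero have "\<forall>m\<in>{1, 2, 3, 4, 9, 10, 11, 13, 15, 16, 17, 23, 24, 25, 26, 27, 28, 29, 30, 31, 32}.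
      (\<Sum>k\<in>P5_indices. c k * bfs_dof x m (L k)) = 0"
    by blast
  note zero = this[unfolded ball_simps dofs]
  show ?thesis
    by (rule P5_deriv_kernel; simp only: zero D00 D10 D01 D11 mult_zero_right)
qed

text \<open>Evaluating 21 functionals on 21 local monomials gives a square system with trivial
  kernel, whence both uniqueness and existence.\<close>

lemma P5_unisolvent:
  assumes "axis_square T x"
  shows "q \<in> P_space 5 \<Longrightarrow> \<forall>m\<in>P5_dofs. bfs_dof x m q = 0 \<Longrightarrow> q = 0"
    and "\<exists>q\<in>P_space 5. \<forall>m\<in>P5_dofs. bfs_dof x m q = v m"
proof -
  obtain h where h: "h > 0" "x 2 = x 1 + (h, 0)" "x 3 = x 1 + (h, h)" "x 4 = x 1 + (0, h)"
    using assms by (auto simp: axis_square_def)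
  obtain a b where ab: "x 1 = (a, b)" by force
  define L where "L = (\<lambda>(i, j). lmono a b h i j)"
  have kernel: "\<forall>k\<in>P5_indices. c k = 0"
    if "\<forall>m\<in>P5_dofs. (\<Sum>k\<in>P5_indices. c k * bfs_dof x m (L k)) = 0" for c
    by (rule P5_dofs_kernel[OF _ _ _ _ _ L_def that]) (use h ab in auto)
  have "{lmono a b h i j | i j. i + j \<le> 5} = L ` P5_indices"
    by (force simp: L_def P5_indices_def image_iff)
  hence P5: "P_space 5 = plane_fun.span (L ` P5_indices)"
    using P_space_eq_span_lmono[of h 5 a b] h by simp
  have dof_sum: "bfs_dof x m (\<Sum>k\<in>P5_indices. fscale (c k) (L k)) =
      (\<Sum>k\<in>P5_indices. c k * bfs_dof x m (L k))" if "m \<in> P5_dofs" for m c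
  proof (rule linear_on_polys_sum[OF linear_on_polys_bfs_dof])
    show "m \<in> {1..36}"
      using that by (auto simp: P5_dofs_def)
    show "L k \<in> polys" if "k \<in> P5_indices" for k
    proof -
      have "L k \<in> P_space 5"
        unfolding P5 by (intro plane_fun.span_base imageI that)
      thus ?thesis
        using P_space_subset_polys by blast
    qed
  qed
  have fin: "finite P5_indices" "finite P5_dofs"
    by (simp_all add: P5_indices_def P5_dofs_def)
  have "card P5_indices = 21"
    using sum_P5_indices[of "\<lambda>_. 1"] by simp
  moreover have "card P5_dofs = 21"
    unfolding P5_dofs_def by (subst card_Diff_subset) simp_all
  ultimately have card: "card P5_indices = card P5_dofs" by simp
  show "q = 0" if "q \<in> P_space 5" "\<forall>m\<in>P5_dofs. bfs_dof x m q = 0"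
  proof -
    from that(1) obtain c where q: "q = (\<Sum>k\<in>P5_indices. fscale (c k) (L k))"
      unfolding P5 by (rule in_span_imageE[OF fin(1)])
    with that(2) have "\<forall>k\<in>P5_indices. c k = 0"
      by (intro kernel) (simp add: dof_sum)
    thus ?thesis
      by (simp add: q)
  qed
  obtain c where c: "\<forall>m\<in>P5_dofs. (\<Sum>k\<in>P5_indices. c k * bfs_dof x m (L k)) = v m"
    using square_system_solvable[OF fin card, of "\<lambda>m k. bfs_dof x m (L k)" v] kernel by blast
  have "(\<Sum>k\<in>P5_indices. fscale (c k) (L k)) \<in> P_space 5"
    unfolding P5 by (intro plane_fun.span_sum plane_fun.span_scale plane_fun.span_base imageI)
  with c show "\<exists>q\<in>P_space 5. \<forall>m\<in>P5_dofs. bfs_dof x m q = v m"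
    by (intro bexI[of _ "\<Sum>k\<in>P5_indices. fscale (c k) (L k)"]) (simp_all add: dof_sum)
qed

section \<open>Unisolvence on the enriched space\<close>

theorem lemma3p1:
  fixes T :: "(real \<times> real) set"
    and x :: "nat \<Rightarrow> real \<times> real"
    and b :: "nat \<Rightarrow> plane_fun"
  assumes "axis_square T x"
    and "bfs_dual_basis x b"
  shows "\<forall>v :: real list. length v = 32 \<longrightarrow>
           (\<exists>!p. p \<in> V5 b \<and> map (\<lambda>F. F p) (boundary_dofs x) = v)"
proof (intro allI impI)
  fix v :: "real list"
  assume v: "length v = 32"
  have lin: "linear_on_polys (bfs_dof x m)" if "m \<in> {1..32}" for m
    using that by (intro linear_on_polys_bfs_dof) auto
  have P5_polys: "P_space 5 \<subseteq> polys"
    by (rule P_space_subset_polys)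
  have b_polys: "b n \<in> polys" if "n \<in> added_dofs" for n
  proof -
    have "n \<in> {1..36}" using that by auto
    thus ?thesis
      using assms(2) Q_space_subset_polys unfolding bfs_dual_basis_def by blast
  qed
  have dual: "bfs_dof x m (b n) = (if m = n then 1 else 0)"
    if "m \<in> {1..32}" "n \<in> added_dofs" for m n
  proof -
    have "m \<in> {1..36}" "n \<in> {1..36}" using that by auto
    thus ?thesis
      using assms(2) unfolding bfs_dual_basis_def by blast
  qed
  \<comment> \<open>By duality a combination of the added functions is invisible to
    \<open>P5_dofs\<close>, while each functional in \<open>added_dofs\<close> reads off its own
    coefficient.\<close>
  have dof_b: "bfs_dof x m (\<Sum>n\<in>added_dofs. fscale (c n) (b n)) =
      (if m \<in> added_dofs then c m else 0)" if m: "m \<in> {1..32}" for m c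
  proof -
    have "bfs_dof x m (\<Sum>n\<in>added_dofs. fscale (c n) (b n)) =
        (\<Sum>n\<in>added_dofs. c n * bfs_dof x m (b n))"
      by (intro linear_on_polys_sum lin m b_polys)
    also have "\<dots> = (\<Sum>n\<in>added_dofs. if m = n then c n else 0)"
      by (intro sum.cong refl) (use dual m in simp)
    also have "\<dots> = (if m \<in> added_dofs then c m else 0)"
      by (rule sum.delta') simp
    finally show ?thesis .
  qed
  have sum_b: "(\<Sum>n\<in>added_dofs. fscale (c n) (b n)) \<in> plane_fun.span (b ` added_dofs)" for c
    by (intro plane_fun.span_sum plane_fun.span_scale plane_fun.span_base imageI)
  have b_span: "plane_fun.span (b ` added_dofs) \<subseteq> polys"
    using b_polys by (intro plane_fun.span_minimal plane_fun.subspace_span) blast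
  have dof_add: "bfs_dof x m (q + s) = bfs_dof x m q + bfs_dof x m s"
    if "m \<in> {1..32}" "q \<in> polys" "s \<in> polys" for m q s
    using lin[OF that(1)] that(2,3) unfolding linear_on_polys_def by blast
  have V5_eq: "V5 b = {q + s | q s. q \<in> P_space 5 \<and> s \<in> plane_fun.span (b ` added_dofs)}"
    unfolding V5_def plane_fun.span_Un P_space_def plane_fun.span_span by (rule refl)
  \<comment> \<open>Functionals are numbered from 1 and list positions from 0, hence the shift in
    \<open>v ! (m - 1)\<close>.\<close>
  have attains: "map (\<lambda>F. F p) (boundary_dofs x) = v \<longleftrightarrow>
      (\<forall>m\<in>{1..32}. bfs_dof x m p = v ! (m - 1))" for p
  proof -
    have "map (\<lambda>F. F p) (boundary_dofs x) = v \<longleftrightarrow>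
        (\<forall>m<32. (boundary_dofs x ! m) p = v ! m)"
      by (auto simp: list_eq_iff_nth_eq length_boundary_dofs v)
    also have "\<dots> \<longleftrightarrow> (\<forall>m<32. bfs_dof x (Suc m) p = v ! m)"
      by (simp add: bfs_dof_def nth_append length_boundary_dofs)
    also have "\<dots> \<longleftrightarrow> (\<forall>m\<in>{1..32}. bfs_dof x m p = v ! (m - 1))"
      unfolding image_Suc_lessThan[symmetric] by auto
    finally show ?thesis .
  qed
  \<comment> \<open>The functionals in \<open>P5_dofs\<close> see only the quintic part and force it
    to vanish; those in \<open>added_dofs\<close> then give the coefficients of the other
    part.\<close>
  have kernel: "p = 0" if p: "p \<in> V5 b" "\<forall>m\<in>{1..32}. bfs_dof x m p = 0" for p
  proof -
    obtain q s where qs: "p = q + s" "q \<in> P_space 5" "s \<in> plane_fun.span (b ` added_dofs)"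
      using p(1) V5_eq by auto
    obtain c where c: "s = (\<Sum>n\<in>added_dofs. fscale (c n) (b n))"
      by (rule in_span_imageE[OF _ qs(3)]) auto
    have sum_eq: "bfs_dof x m q + (if m \<in> added_dofs then c m else 0) = 0" if "m \<in> {1..32}" for m
    proof -
      have "q \<in> polys" "s \<in> polys"
        using qs P5_polys b_span by blast+
      from dof_add[OF that this] have "bfs_dof x m q + bfs_dof x m s = 0"
        using p(2) that qs(1) by simp
      thus ?thesis
        unfolding c dof_b[OF that] .
    qed
    have "\<forall>m\<in>P5_dofs. bfs_dof x m q = 0"
    proof
      fix m assume "m \<in> P5_dofs"
      thus "bfs_dof x m q = 0"
        using sum_eq[of m] by (simp add: P5_dofs_def)
    qed
    hence q: "q = 0"
      using P5_unisolvent(1)[OF assms(1) qs(2)] by blast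
    have "c m = 0" if "m \<in> added_dofs" for m
    proof -
      have m: "m \<in> {1..32}" using that by auto
      have "bfs_dof x m 0 = 0"
        using lin[OF m] plane_fun.span_zero plane_fun.scale_zero_left
        unfolding linear_on_polys_def by (metis mult_zero_left)
      thus ?thesis using sum_eq[OF m] that q by simp
    qed
    hence "s = 0"
      unfolding c by (intro sum.neutral) simp
    thus "p = 0" using qs q by simp
  qed
  show "\<exists>!p. p \<in> V5 b \<and> map (\<lambda>F. F p) (boundary_dofs x) = v"
    unfolding attains
  proof (rule ex_ex1I)
    obtain q where q: "q \<in> P_space 5" "\<forall>m\<in>P5_dofs. bfs_dof x m q = v ! (m - 1)"
      using P5_unisolvent(2)[OF assms(1), of "\<lambda>m. v ! (m - 1)"] by blast
    \<comment> \<open>The correction supplies what \<open>q\<close> misses at the functionals in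
      \<open>added_dofs\<close> and leaves its values on \<open>P5_dofs\<close> unchanged.\<close>
    define s where "s = (\<Sum>n\<in>added_dofs. fscale (v ! (n - 1) - bfs_dof x n q) (b n))"
    have s: "s \<in> plane_fun.span (b ` added_dofs)"
      unfolding s_def by (rule sum_b)
    have "bfs_dof x m (q + s) = v ! (m - 1)" if "m \<in> {1..32}" for m
    proof -
      have "q \<in> polys" "s \<in> polys"
        using q(1) s P5_polys b_span by blast+
      from dof_add[OF that this] have "bfs_dof x m (q + s) = bfs_dof x m q +
          (if m \<in> added_dofs then v ! (m - 1) - bfs_dof x m q else 0)"
        unfolding s_def dof_b[OF that] .
      thus ?thesis
        using q(2) that by (simp add: P5_dofs_def)
    qed
    moreover have "q + s \<in> V5 b"
      using V5_eq q(1) s by blast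
    ultimately show "\<exists>p. p \<in> V5 b \<and> (\<forall>m\<in>{1..32}. bfs_dof x m p = v ! (m - 1))"
      by blast
  next
    fix p p' assume p: "p \<in> V5 b \<and> (\<forall>m\<in>{1..32}. bfs_dof x m p = v ! (m - 1))"
      and p': "p' \<in> V5 b \<and> (\<forall>m\<in>{1..32}. bfs_dof x m p' = v ! (m - 1))"
    have V5_polys: "V5 b \<subseteq> polys"
      unfolding V5_eq using P5_polys b_span plane_fun.span_add by blast
    have diff: "p - p' \<in> V5 b"
      using p p' unfolding V5_def by (intro plane_fun.span_diff) auto
    have "bfs_dof x m (p - p') = 0" if "m \<in> {1..32}" for m
    proof -
      \<comment> \<open>Linearity is stated for sums, so the difference is handled by adding
        \<open>p'\<close> back.\<close>
      have "bfs_dof x m ((p - p') + p') = bfs_dof x m (p - p') + bfs_dof x m p'"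
        using diff p' V5_polys by (intro dof_add that) auto
      thus ?thesis using p p' that by (simp only: diff_add_cancel)
    qed
    with kernel[OF diff] have "p - p' = 0" by blast
    thus "p = p'" by (rule right_minus_eq[THEN iffD1])
  qed
qed
end
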